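(* Let $\kappa$ be an infinite cardinal, let $\lambda$ be an infinite regular cardinal, and let $(\mu_\gamma)_{\gamma\in\kappa}$ be a sequence of infinite regular cardinals. Then the product space $\prod_{\gamma\in\kappa}\mu_\gamma$ (each $\mu_\gamma$ with the order topology, the product with the Tychonoff topology) is $[\lambda,\lambda]$-compact if and only if $\lambda\not\Rightarrow(\mu_\gamma)_{\gamma\in\kappa}$, that is, if and only if the following holds: for every sequence of functions $(f_\gamma)_{\gamma\in\kappa}$ with $f_\gamma:\lambda\to\mu_\gamma$ for each $\gamma\in\kappa$, there is some uniform ultrafilter $D$ over $\lambda$ such that for no $\gamma\in\kappa$ is $f_\gamma(D)$ uniform over $\mu_\gamma$.
   Context: A topological space $X$ is $[\mu,\lambda]$-compact if every open cover of $X$ by at most $\lambda$ sets has a subcover by fewer than $\mu$ sets. Thus $X$ is $[\lambda,\lambda]$-compact if every open cover by at most $\lambda$ sets has a subcover by fewer than $\lambda$ sets. An ultrafilter over an infinite cardinal $\nu$ is uniform if all of its members have cardinality $\nu$. If $D$ is an ultrafilter over a set $I$ and $f:I\to J$ is a function, $f(D)$ is the ultrafilter over $J$ defined by $Y\in f(D)$ if and only if $f^{-1}(Y)\in D$. *)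

theory Defs
  imports "HOL-Analysis.Analysis"
begin

unbundle cardinal_syntax

(* A cardinal is a relation r with Card_order r, that is, a well-order of Field r of least
   order type among the well-orders of Field r; the points of the cardinal are the elements
   of Field r, ordered by r. *)

(* The open rays of r form a subbase; Field r is added only so that the topspace is Field r
   also when Field r has a single point. *)
definition order_topology_of :: "'a rel \<Rightarrow> 'a topology" where
  "order_topology_of r =
     topology_generated_by
       (insert (Field r) (underS r ` Field r \<union> aboveS r ` Field r))"

lemma topspace_order_topology_of [simp]: "topspace (order_topology_of r) = Field r"
  by (auto simp: order_topology_of_def underS_def aboveS_def Field_def)

(* [\<mu>, lam]-compactness; only the cardinalities of the first two arguments matter. *)
definition interval_compact_space :: "'m rel \<Rightarrow> 'l rel \<Rightarrow> 'a topology \<Rightarrow> bool" where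
  "interval_compact_space \<mu> lam X \<longleftrightarrow>
     (\<forall>\<U>. (\<forall>U\<in>\<U>. openin X U) \<and> \<Union>\<U> = topspace X \<and> |\<U>| \<le>o lam \<longrightarrow>
        (\<exists>\<V>\<subseteq>\<U>. \<Union>\<V> = topspace X \<and> |\<V>| <o \<mu>))"

definition ultrafilter_over :: "'a set \<Rightarrow> 'a set set \<Rightarrow> bool" where
  "ultrafilter_over I D \<longleftrightarrow>
     D \<subseteq> Pow I \<and> I \<in> D \<and> {} \<notin> D \<and>
     (\<forall>A\<in>D. \<forall>B\<in>D. A \<inter> B \<in> D) \<and>
     (\<forall>A\<in>D. \<forall>B. A \<subseteq> B \<and> B \<subseteq> I \<longrightarrow> B \<in> D) \<and>
     (\<forall>A\<subseteq>I. A \<in> D \<or> I - A \<in> D)"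

definition uniform_ultrafilter :: "'a rel \<Rightarrow> 'a set set \<Rightarrow> bool" where
  "uniform_ultrafilter \<nu> D \<longleftrightarrow> ultrafilter_over (Field \<nu>) D \<and> (\<forall>A\<in>D. |A| =o \<nu>)"

definition image_ultrafilter ::
    "'a set \<Rightarrow> 'b set \<Rightarrow> ('a \<Rightarrow> 'b) \<Rightarrow> 'a set set \<Rightarrow> 'b set set" where
  "image_ultrafilter I J f D = {Y. Y \<subseteq> J \<and> f -` Y \<inter> I \<in> D}"

(* The arrow relation: some sequence of functions sends every uniform ultrafilter over
   lam to a uniform ultrafilter over \<mu> \<gamma> for at least one \<gamma>. *)
definition ultra_arrow :: "'l rel \<Rightarrow> 'k rel \<Rightarrow> ('k \<Rightarrow> 'm rel) \<Rightarrow> bool" where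
  "ultra_arrow lam \<kappa> \<mu> \<longleftrightarrow>
     (\<exists>f. (\<forall>\<gamma>\<in>Field \<kappa>. f \<gamma> \<in> Field lam \<rightarrow> Field (\<mu> \<gamma>)) \<and>
        (\<forall>D. uniform_ultrafilter lam D \<longrightarrow>
           (\<exists>\<gamma>\<in>Field \<kappa>. uniform_ultrafilter (\<mu> \<gamma>)
              (image_ultrafilter (Field lam) (Field (\<mu> \<gamma>)) (f \<gamma>) D))))"

end

theory Submission
  imports Defs
begin

text \<open>
  For regular \<open>\<lambda>\<close>, \<open>[\<lambda>, \<lambda>]\<close>-compactness says that every \<open>\<lambda>\<close>-sequence has a complete
  accumulation point, and a complete accumulation point of a sequence is the same as its limit
  along some uniform ultrafilter \<open>D\<close> over \<open>\<lambda>\<close>. Limits along \<open>D\<close> in a product are computed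
  componentwise, and in a regular cardinal \<open>\<mu>\<close> the limit of \<open>f\<close> along \<open>D\<close> exists iff some
  bounded set belongs to \<open>f(D)\<close>, that is, iff \<open>f(D)\<close> is not uniform: the limit is then the
  least \<open>p\<close> with \<open>{q. q \<le> p} \<in> f(D)\<close>.
\<close>

subsection \<open>Cardinals\<close>

lemma card_of_ordLess_mono: "A \<subseteq> B \<Longrightarrow> |B| <o r \<Longrightarrow> |A| <o r"
  by (rule ordLeq_ordLess_trans[OF card_of_mono1])

lemma Cinfinite_ordLess_Un:
  assumes "Cinfinite r" "|A| <o r" "|B| <o r"
  shows "|A \<union> B| <o r"
  using assms card_of_Un_ordLess_infinite_Field[of r A B] by (auto simp: cinfinite_def)

lemma Card_order_not_under_iff:
  assumes "Card_order r" "a \<in> Field r" "b \<in> Field r"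
  shows "b \<notin> under r a \<longleftrightarrow> b \<in> aboveS r a"
proof -
  have wo: "Well_order r" using assms(1) by (rule card_order_on_well_order_on)
  have "(a, b) \<in> r \<or> (b, a) \<in> r"
    using wo_rel.TOTALS[of r] wo assms(2,3) by (auto simp: wo_rel_def)
  moreover have "(a, b) \<in> r \<Longrightarrow> (b, a) \<in> r \<Longrightarrow> a = b"
    using wo_rel.ANTISYM[of r] wo by (auto simp: wo_rel_def antisym_def)
  moreover have "(a, a) \<in> r"
    using wo_rel.REFL[of r] wo assms(2) by (auto simp: wo_rel_def refl_on_def)
  ultimately show ?thesis by (auto simp: under_def aboveS_def)
qed

text \<open>An infinite cardinal is a limit ordinal, so no point is last. This puts closed initial
  segments inside open ones, which bounds their size below \<open>r\<close> and gives each point a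
  bounded open neighbourhood.\<close>

lemma Cinfinite_under_subset_underS:
  assumes "Cinfinite r" "a \<in> Field r"
  obtains b where "b \<in> Field r" "a \<in> underS r b" "under r a \<subseteq> underS r b"
proof -
  from assms obtain b where b: "b \<in> Field r" "a \<noteq> b" "(a, b) \<in> r"
    using infinite_Card_order_limit[of r a] by (auto simp: cinfinite_def)
  have wo: "wo_rel r"
    using assms(1) by (auto simp: wo_rel_def intro: card_order_on_well_order_on)
  show thesis
  proof (rule that[OF b(1)])
    show "a \<in> underS r b" using b by (simp add: underS_def)
    show "under r a \<subseteq> underS r b"
    proof
      fix c assume "c \<in> under r a"
      then have c: "(c, a) \<in> r" by (simp add: under_def)
      have "(c, b) \<in> r" using wo_rel.TRANS[OF wo] c b(3) by (auto dest: transD)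
      moreover have "c \<noteq> b"
        using wo_rel.ANTISYM[OF wo] c b(2,3) by (auto dest: antisymD)
      ultimately show "c \<in> underS r b" by (simp add: underS_def)
    qed
  qed
qed

lemma Cinfinite_card_of_under:
  assumes "Cinfinite r" "a \<in> Field r"
  shows "|under r a| <o r"
proof -
  obtain b where b: "b \<in> Field r" "under r a \<subseteq> underS r b"
    using Cinfinite_under_subset_underS[OF assms] .
  have "|underS r b| <o r" using assms(1) b(1) by (simp add: card_of_underS)
  with b(2) show ?thesis by (rule card_of_ordLess_mono)
qed

text \<open>Regularity in the form used throughout: a subset that is not of full size is not
  cofinal, so some \<open>a\<close> has no element of \<open>K\<close> strictly above it, and
  totality turns this into an upper bound.\<close>

lemma regularCard_bounded:
  assumes "Card_order r" "regularCard r" "K \<subseteq> Field r" "\<not> |K| =o (r :: 'a rel)"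
  obtains a where "a \<in> Field r" "K \<subseteq> under r a"
proof -
  have "\<not> cofinal K r"
    using assms by (auto simp: regularCard_def)
  then obtain a where a: "a \<in> Field r" "\<And>b. b \<in> K \<Longrightarrow> a = b \<or> (a, b) \<notin> r"
    by (auto simp: cofinal_def)
  show thesis
  proof (rule that[OF a(1)], rule subsetI)
    fix b assume "b \<in> K"
    then have "b \<notin> aboveS r a" using a(2) by (auto simp: aboveS_def)
    with \<open>b \<in> K\<close> show "b \<in> under r a"
      using Card_order_not_under_iff[OF assms(1) a(1)] assms(3) by blast
  qed
qed

lemma Card_order_card_of_subset_cases:
  assumes "Card_order r" "A \<subseteq> Field r"
  shows "|A| <o r \<or> |A| =o r"
  using ordLeq_ordIso_trans[OF card_of_mono1[OF assms(2)] card_of_Field_ordIso[OF assms(1)]]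
  by (simp add: ordLeq_iff_ordLess_or_ordIso)

subsection \<open>Ultrafilters\<close>

text \<open>Proper filters, that is, \<open>ultrafilter_over\<close> without the maximality clause.
  Properness is built in so that maximal elements under inclusion are the ultrafilters.\<close>

definition filter_over :: "'a set \<Rightarrow> 'a set set \<Rightarrow> bool" where
  "filter_over I F \<longleftrightarrow>
     F \<subseteq> Pow I \<and> I \<in> F \<and> {} \<notin> F \<and>
     (\<forall>A\<in>F. \<forall>B\<in>F. A \<inter> B \<in> F) \<and>
     (\<forall>A\<in>F. \<forall>B. A \<subseteq> B \<and> B \<subseteq> I \<longrightarrow> B \<in> F)"

lemma ultrafilter_over_iff:
  "ultrafilter_over I D \<longleftrightarrow> filter_over I D \<and> (\<forall>A\<subseteq>I. A \<in> D \<or> I - A \<in> D)"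
  unfolding ultrafilter_over_def filter_over_def by (simp only: conj_assoc)

lemma
  assumes "filter_over I F"
  shows filter_over_subset: "A \<in> F \<Longrightarrow> A \<subseteq> I"
    and filter_over_top: "I \<in> F"
    and filter_over_empty: "{} \<notin> F"
    and filter_over_Int: "A \<in> F \<Longrightarrow> B \<in> F \<Longrightarrow> A \<inter> B \<in> F"
    and filter_over_mono: "A \<in> F \<Longrightarrow> A \<subseteq> B \<Longrightarrow> B \<subseteq> I \<Longrightarrow> B \<in> F"
  using assms by (auto simp: filter_over_def)

lemma ultrafilter_over_imp_filter_over: "ultrafilter_over I D \<Longrightarrow> filter_over I D"
  by (simp add: ultrafilter_over_iff)

text \<open>The only delicate clause is closure under intersection: two sets from different members
  of the chain both lie in the larger member.\<close>

lemma filter_over_chain_Union: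
  assumes "subset.chain {F. filter_over I F} C" "C \<noteq> {}"
  shows "filter_over I (\<Union>C)"
proof -
  have C: "F \<in> C \<Longrightarrow> filter_over I F" for F
    using assms(1) by (auto simp: subset_chain_def)
  have "A \<inter> B \<in> \<Union>C" if AB: "A \<in> \<Union>C" "B \<in> \<Union>C" for A B
  proof -
    obtain F G where "F \<in> C" "G \<in> C" "A \<in> F" "B \<in> G" using AB by blast
    moreover have "F \<subseteq> G \<or> G \<subseteq> F"
      using assms(1) \<open>F \<in> C\<close> \<open>G \<in> C\<close> by (auto simp: subset_chain_def)
    ultimately obtain H where "H \<in> C" "A \<in> H" "B \<in> H" by blast
    then show ?thesis using filter_over_Int[OF C] by blast
  qed
  moreover have "I \<in> \<Union>C" using assms(2) filter_over_top[OF C] by blast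
  moreover have "B \<in> \<Union>C" if "A \<in> \<Union>C" "A \<subseteq> B" "B \<subseteq> I" for A B
    using that filter_over_mono[OF C] by blast
  moreover have "\<Union>C \<subseteq> Pow I" "{} \<notin> \<Union>C"
    using filter_over_subset[OF C] filter_over_empty[OF C] by blast+
  ultimately show ?thesis unfolding filter_over_def by blast
qed

text \<open>Zorn's lemma gives a maximal filter above \<open>F\<close>. If it contained neither
  \<open>A\<close> nor its complement, adjoining \<open>A\<close> would enlarge it.\<close>

lemma filter_over_extends_to_ultrafilter:
  assumes "filter_over I F"
  obtains D where "ultrafilter_over I D" "F \<subseteq> D"
proof -
  let ?P = "{G. filter_over I G \<and> F \<subseteq> G}"
  have "\<exists>M\<in>?P. \<forall>G\<in>?P. M \<subseteq> G \<longrightarrow> G = M"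
  proof (rule subset_Zorn_nonempty)
    show "?P \<noteq> {}" using assms by blast
    fix C assume C: "C \<noteq> {}" "subset.chain ?P C"
    then have "subset.chain {G. filter_over I G} C" "F \<subseteq> \<Union>C"
      unfolding subset_chain_def by blast+
    with C(1) show "\<Union>C \<in> ?P" using filter_over_chain_Union by simp
  qed
  then obtain D where DP: "D \<in> ?P" and max: "\<forall>G\<in>?P. D \<subseteq> G \<longrightarrow> G = D"
    by (rule bexE)
  from DP have D: "filter_over I D" "F \<subseteq> D" by simp_all
  have "I - A \<in> D" if A: "A \<subseteq> I" "A \<notin> D" for A
  proof (rule ccontr)
    assume nA: "I - A \<notin> D"
    \<comment> \<open>The filter generated by \<open>D\<close> and \<open>A\<close>. It is proper
      because a \<open>C\<close> in \<open>D\<close> disjoint from \<open>A\<close> would force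
      \<open>I - A\<close> into \<open>D\<close>.\<close>
    let ?G = "{B. B \<subseteq> I \<and> (\<exists>C\<in>D. C \<inter> A \<subseteq> B)}"
    have nonempty: "C \<inter> A \<noteq> {}" if "C \<in> D" for C
    proof
      assume "C \<inter> A = {}"
      then have "C \<subseteq> I - A" using filter_over_subset[OF D(1) that] by blast
      then show False using filter_over_mono[OF D(1) that] nA by blast
    qed
    have "filter_over I ?G"
      unfolding filter_over_def
    proof (intro conjI ballI allI impI)
      show "I \<in> ?G" using filter_over_top[OF D(1)] by blast
      show "{} \<notin> ?G" using nonempty by blast
    next
      fix B B' assume "B \<in> ?G" "B' \<in> ?G"
      then obtain C C' where "C \<in> D" "C' \<in> D" "C \<inter> A \<subseteq> B" "C' \<inter> A \<subseteq> B'" "B \<subseteq> I" by blast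
      moreover from this have "C \<inter> C' \<in> D" by (intro filter_over_Int[OF D(1)])
      ultimately show "B \<inter> B' \<in> ?G" by blast
    qed blast+
    moreover have "D \<subseteq> ?G" using filter_over_subset[OF D(1)] by blast
    ultimately have "?G = D" using max D(2) by simp
    moreover have "A \<in> ?G" using A(1) filter_over_top[OF D(1)] by blast
    ultimately show False using A(2) by blast
  qed
  with D(1) have "ultrafilter_over I D" by (auto simp: ultrafilter_over_iff)
  then show thesis using D(2) by (rule that)
qed

text \<open>Preimages commute with intersections and complements. That \<open>f\<close> maps
  \<open>I\<close> into \<open>J\<close> makes the preimage of \<open>J\<close> all of
  \<open>I\<close>, and the preimage of \<open>J - A\<close> the complement in \<open>I\<close> of
  that of \<open>A\<close>.\<close>

lemma ultrafilter_over_image: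
  assumes "ultrafilter_over I D" "f \<in> I \<rightarrow> J"
  shows "ultrafilter_over J (image_ultrafilter I J f D)"
proof -
  have D: "filter_over I D" "\<And>A. A \<subseteq> I \<Longrightarrow> A \<in> D \<or> I - A \<in> D"
    using assms(1) by (auto simp: ultrafilter_over_iff)
  have f: "f -` J \<inter> I = I" "\<And>A. f -` (J - A) \<inter> I = I - (f -` A \<inter> I)"
    using assms(2) by blast+
  show ?thesis
    unfolding ultrafilter_over_iff filter_over_def
  proof (intro conjI ballI allI impI)
    show "J \<in> image_ultrafilter I J f D" "{} \<notin> image_ultrafilter I J f D"
      using f filter_over_top[OF D(1)] filter_over_empty[OF D(1)]
      by (auto simp: image_ultrafilter_def)
    fix A B assume A: "A \<in> image_ultrafilter I J f D"
    {
      assume "B \<in> image_ultrafilter I J f D"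
      then have "(f -` A \<inter> I) \<inter> (f -` B \<inter> I) \<in> D"
        using A filter_over_Int[OF D(1)] by (simp add: image_ultrafilter_def)
      moreover have "f -` (A \<inter> B) \<inter> I = (f -` A \<inter> I) \<inter> (f -` B \<inter> I)" by blast
      ultimately show "A \<inter> B \<in> image_ultrafilter I J f D"
        using A by (auto simp: image_ultrafilter_def)
    next
      assume B: "A \<subseteq> B \<and> B \<subseteq> J"
      then have "f -` A \<inter> I \<subseteq> f -` B \<inter> I" by blast
      then have "f -` B \<inter> I \<in> D"
        using A filter_over_mono[OF D(1), of "f -` A \<inter> I"] by (simp add: image_ultrafilter_def)
      with B show "B \<in> image_ultrafilter I J f D" by (simp add: image_ultrafilter_def)
    }
  next
    fix A assume A: "A \<subseteq> J"
    have "f -` A \<inter> I \<in> D \<or> I - (f -` A \<inter> I) \<in> D" using D(2) by blast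
    with A f(2)[of A] show "A \<in> image_ultrafilter I J f D \<or> J - A \<in> image_ultrafilter I J f D"
      by (auto simp: image_ultrafilter_def)
  qed (auto simp: image_ultrafilter_def)
qed

subsection \<open>Limits along ultrafilters\<close>

text \<open>Convergence of the family \<open>x\<close> to \<open>p\<close> along \<open>D\<close>.
  Preimages are cut down to \<open>I\<close> because functions are total on the type.\<close>

definition ultra_limit ::
    "'i set \<Rightarrow> 'i set set \<Rightarrow> 'a topology \<Rightarrow> ('i \<Rightarrow> 'a) \<Rightarrow> 'a \<Rightarrow> bool" where
  "ultra_limit I D X x p \<longleftrightarrow>
     p \<in> topspace X \<and> (\<forall>U. openin X U \<and> p \<in> U \<longrightarrow> x -` U \<inter> I \<in> D)"

text \<open>Convergence need only be tested on a subbase: finite intersections are absorbed by the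
  filter, and for a union one member containing \<open>p\<close> already suffices by upward
  closure.\<close>

lemma ultra_limit_topology_generated_by:
  assumes D: "filter_over I D" and p: "p \<in> \<Union>S"
    and sub: "\<And>U. U \<in> S \<Longrightarrow> p \<in> U \<Longrightarrow> x -` U \<inter> I \<in> D"
  shows "ultra_limit I D (topology_generated_by S) x p"
proof -
  have "x -` U \<inter> I \<in> D" if "generate_topology_on S U" "p \<in> U" for U
    using that
  proof (induction rule: generate_topology_on.induct)
    case (Int A B)
    then have "(x -` A \<inter> I) \<inter> (x -` B \<inter> I) \<in> D"
      using filter_over_Int[OF D] by simp
    moreover have "(x -` A \<inter> I) \<inter> (x -` B \<inter> I) = x -` (A \<inter> B) \<inter> I" by blast
    ultimately show ?case by simp
  next
    case (UN K)
    then obtain A where A: "A \<in> K" "x -` A \<inter> I \<in> D" by blast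
    then have "x -` A \<inter> I \<subseteq> x -` \<Union>K \<inter> I" by blast
    then show ?case using filter_over_mono[OF D A(2)] by blast
  qed (use sub in auto)
  with p show ?thesis
    by (auto simp: ultra_limit_def openin_topology_generated_by_iff)
qed

text \<open>Forwards, projections are continuous. Backwards, a basic open box restricts only
  finitely many coordinates, and a filter is closed under finite intersections.\<close>

lemma ultra_limit_product_topology:
  assumes D: "filter_over I D"
    and x: "x \<in> I \<rightarrow> (\<Pi>\<^sub>E k\<in>K. topspace (X k))" and p: "p \<in> (\<Pi>\<^sub>E k\<in>K. topspace (X k))"
  shows "ultra_limit I D (product_topology X K) x p \<longleftrightarrow>
         (\<forall>k\<in>K. ultra_limit I D (X k) (\<lambda>i. x i k) (p k))"
proof (intro iffI ballI)
  fix k assume lim: "ultra_limit I D (product_topology X K) x p" and k: "k \<in> K"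
  have "(\<lambda>i. x i k) -` U \<inter> I \<in> D" if U: "openin (X k) U" "p k \<in> U" for U
  proof -
    let ?V = "{q \<in> topspace (product_topology X K). q k \<in> U}"
    have "openin (product_topology X K) ?V"
      using continuous_map_product_projection[OF k] U(1) by (rule openin_continuous_map_preimage)
    moreover have "p \<in> ?V" using p U(2) by simp
    ultimately have "x -` ?V \<inter> I \<in> D" using lim unfolding ultra_limit_def by blast
    moreover have "x -` ?V \<inter> I = (\<lambda>i. x i k) -` U \<inter> I" using x by auto
    ultimately show ?thesis by simp
  qed
  then show "ultra_limit I D (X k) (\<lambda>i. x i k) (p k)"
    using p k by (auto simp: ultra_limit_def)
next
  assume lim: "\<forall>k\<in>K. ultra_limit I D (X k) (\<lambda>i. x i k) (p k)"
  have "x -` U \<inter> I \<in> D" if U: "openin (product_topology X K) U" "p \<in> U" for U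
  proof -
    obtain B where B: "finite {k \<in> K. B k \<noteq> topspace (X k)}" "\<And>k. k \<in> K \<Longrightarrow> openin (X k) (B k)"
      "p \<in> Pi\<^sub>E K B" "Pi\<^sub>E K B \<subseteq> U"
      using U unfolding openin_product_topology_alt by meson
    let ?J = "{k \<in> K. B k \<noteq> topspace (X k)}"
    have fin: "{i \<in> I. \<forall>k\<in>J. x i k \<in> B k} \<in> D" if "finite J" "J \<subseteq> K" for J
      using that
    proof (induction J rule: finite_induct)
      case empty
      then show ?case using filter_over_top[OF D] by simp
    next
      case (insert k J)
      have "(\<lambda>i. x i k) -` B k \<inter> I \<in> D"
        using lim insert.prems B(2,3) by (auto simp: ultra_limit_def PiE_iff)
      with insert have "((\<lambda>i. x i k) -` B k \<inter> I) \<inter> {i \<in> I. \<forall>k\<in>J. x i k \<in> B k} \<in> D"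
        using filter_over_Int[OF D] by simp
      moreover have "((\<lambda>i. x i k) -` B k \<inter> I) \<inter> {i \<in> I. \<forall>k\<in>J. x i k \<in> B k} =
          {i \<in> I. \<forall>k\<in>insert k J. x i k \<in> B k}" by auto
      ultimately show ?case by simp
    qed
    have "{i \<in> I. \<forall>k\<in>?J. x i k \<in> B k} \<in> D" using fin[OF B(1)] by blast
    moreover have "{i \<in> I. \<forall>k\<in>?J. x i k \<in> B k} \<subseteq> x -` U \<inter> I"
    proof
      fix i assume i: "i \<in> {i \<in> I. \<forall>k\<in>?J. x i k \<in> B k}"
      then have xi: "x i \<in> (\<Pi>\<^sub>E k\<in>K. topspace (X k))" using x by blast
      \<comment> \<open>Outside \<open>?J\<close> the factor \<open>B k\<close> is the whole space,
        so membership there follows from \<open>x i\<close> being a point of the product.\<close>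
      have "x i k \<in> B k" if "k \<in> K" for k
        using i xi that by (cases "B k = topspace (X k)") (auto simp: PiE_iff)
      with xi have "x i \<in> Pi\<^sub>E K B" by (auto simp: PiE_iff)
      with i B(4) show "i \<in> x -` U \<inter> I" by blast
    qed
    ultimately show ?thesis by (rule filter_over_mono[OF D]) blast
  qed
  then show "ultra_limit I D (product_topology X K) x p"
    using p by (simp add: ultra_limit_def)
qed

text \<open>A limit has a bounded open neighbourhood, and this is a member of the image of size
  below \<open>r\<close>. Conversely, regularity bounds any member of the image that is too small,
  so some closed initial segment belongs to the image.\<close>

lemma ultra_limit_order_topology_iff:
  assumes r: "Cinfinite r" "regularCard r"
    and D: "ultrafilter_over I D" and f: "f \<in> I \<rightarrow> Field r"
  shows "(\<exists>p. ultra_limit I D (order_topology_of r) f p) \<longleftrightarrow>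
         \<not> uniform_ultrafilter r (image_ultrafilter I (Field r) f D)"
    (is "?lim \<longleftrightarrow> \<not> uniform_ultrafilter r ?E")
proof
  assume ?lim
  then obtain p where p: "p \<in> Field r"
    and lim: "\<And>U. openin (order_topology_of r) U \<Longrightarrow> p \<in> U \<Longrightarrow> f -` U \<inter> I \<in> D"
    by (auto simp: ultra_limit_def)
  obtain b where b: "b \<in> Field r" "p \<in> underS r b"
    using Cinfinite_under_subset_underS[OF r(1) p] .
  have "openin (order_topology_of r) (underS r b)"
    unfolding order_topology_of_def using b(1) by (auto intro: topology_generated_by_Basis)
  then have "underS r b \<in> ?E"
    using lim b(2) Order_Relation.underS_Field[of r b] by (auto simp: image_ultrafilter_def)
  moreover have "\<not> |underS r b| =o r"
    using not_ordLess_ordIso[OF card_of_underS[OF _ b(1)]] r(1) by simp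
  ultimately show "\<not> uniform_ultrafilter r ?E" by (auto simp: uniform_ultrafilter_def)
next
  assume "\<not> uniform_ultrafilter r ?E"
  moreover have E: "ultrafilter_over (Field r) ?E" using D f by (rule ultrafilter_over_image)
  ultimately obtain Y where Y: "Y \<in> ?E" "\<not> |Y| =o r" by (auto simp: uniform_ultrafilter_def)
  then have "Y \<subseteq> Field r" by (simp add: image_ultrafilter_def)
  with r Y(2) obtain a where "a \<in> Field r" "Y \<subseteq> under r a"
    using regularCard_bounded[of r Y] by auto
  have E_filter: "filter_over (Field r) ?E"
    using E by (rule ultrafilter_over_imp_filter_over)
  from Y(1) \<open>Y \<subseteq> under r a\<close> under_Field have a: "under r a \<in> ?E"
    by (rule filter_over_mono[OF E_filter])
  have wo: "wo_rel r"
    using r(1) by (auto simp: wo_rel_def intro: card_order_on_well_order_on)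
  \<comment> \<open>The least element of \<open>S\<close> will be the limit; it is checked on the
    subbase of open rays.\<close>
  define S where "S = {a \<in> Field r. under r a \<in> ?E}"
  define p where "p = wo_rel.minim r S"
  have S: "S \<subseteq> Field r" "S \<noteq> {}" using a \<open>a \<in> Field r\<close> by (auto simp: S_def)
  have pS: "p \<in> S" unfolding p_def using wo_rel.minim_in[OF wo S] .
  then have p: "p \<in> Field r" "under r p \<in> ?E" by (auto simp: S_def)
  have least: "(p, b) \<in> r" if "b \<in> S" for b
    unfolding p_def using wo_rel.minim_least[OF wo S(1) that] .
  have "f -` U \<inter> I \<in> D"
    if U: "U \<in> insert (Field r) (underS r ` Field r \<union> aboveS r ` Field r)" "p \<in> U" for U
  proof -
    consider "U = Field r" | b where "b \<in> Field r" "U = underS r b"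
      | b where "b \<in> Field r" "U = aboveS r b" using U(1) by blast
    then have "U \<in> ?E"
    proof cases
      case 1
      then show ?thesis using filter_over_top[OF E_filter] by simp
    next
      case 2
      then have pb: "(p, b) \<in> r" "p \<noteq> b" using U(2) by (auto simp: underS_def)
      have "under r p \<subseteq> underS r b"
        using wo_rel.TRANS[OF wo] wo_rel.ANTISYM[OF wo] pb
        by (auto simp: under_def underS_def dest: transD antisymD)
      then show ?thesis
        using filter_over_mono[OF E_filter p(2)] 2 Order_Relation.underS_Field[of r b] by simp
    next
      \<comment> \<open>Here \<open>b\<close> lies strictly below \<open>p\<close>, so minimality of
        \<open>p\<close> keeps \<open>under r b\<close> out of the image ultrafilter, which
        therefore contains its complement, the ray above \<open>b\<close>.\<close>
      case 3
      then have bp: "(b, p) \<in> r" "p \<noteq> b" using U(2) by (auto simp: aboveS_def)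
      then have "b \<notin> S" using least wo_rel.ANTISYM[OF wo] by (auto dest: antisymD)
      then have "Field r - under r b \<in> ?E"
        using E 3(1) under_Field[of r b] by (auto simp: S_def ultrafilter_over_iff)
      moreover have "Field r - under r b = aboveS r b"
        using Card_order_not_under_iff[of r b] 3(1) r(1) by (auto simp: aboveS_def intro: FieldI2)
      ultimately show ?thesis using 3 by simp
    qed
    then show ?thesis by (simp add: image_ultrafilter_def)
  qed
  then have "ultra_limit I D (order_topology_of r) f p"
    unfolding order_topology_of_def using D p(1)
    by (intro ultra_limit_topology_generated_by) (auto simp: ultrafilter_over_iff)
  then show ?lim by blast
qed

subsection \<open>Complete accumulation points\<close>

text \<open>The count is of indices, not of points: a value repeated at \<open>r\<close> many
  indices is an accumulation point even when the range of \<open>x\<close> is small.\<close>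

definition complete_accumulation_point ::
    "'l rel \<Rightarrow> 'a topology \<Rightarrow> ('l \<Rightarrow> 'a) \<Rightarrow> 'a \<Rightarrow> bool" where
  "complete_accumulation_point r X x p \<longleftrightarrow>
     p \<in> topspace X \<and> (\<forall>U. openin X U \<and> p \<in> U \<longrightarrow> |x -` U \<inter> Field r| =o r)"

text \<open>Preimages of neighbourhoods of \<open>p\<close> together with complements of small index
  sets generate a proper filter exactly when \<open>p\<close> accumulates. Any ultrafilter extending
  it is uniform and converges to \<open>p\<close>. The converse is immediate from
  uniformity.\<close>

lemma complete_accumulation_point_iff_ultra_limit:
  fixes r :: "'l rel"
  assumes r: "Cinfinite r" and x: "x \<in> Field r \<rightarrow> topspace X"
  shows "complete_accumulation_point r X x p \<longleftrightarrow>
         (\<exists>D. uniform_ultrafilter r D \<and> ultra_limit (Field r) D X x p)"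
proof
  assume acc: "complete_accumulation_point r X x p"
  \<comment> \<open>The generated filter in closed form: sets containing the preimage of some
    neighbourhood of \<open>p\<close> up to fewer than \<open>r\<close> indices.\<close>
  let ?F = "{A. A \<subseteq> Field r \<and>
    (\<exists>U. openin X U \<and> p \<in> U \<and> |(x -` U \<inter> Field r) - A| <o r)}"
  have top: "openin X (topspace X)" "p \<in> topspace X"
    using acc by (auto simp: complete_accumulation_point_def)
  obtain a where "a \<in> Field r"
    using r by (metis cinfinite_def equals0I finite.emptyI)
  with r have "|under r a| <o r" by (rule Cinfinite_card_of_under)
  \<comment> \<open>Needed when no index is missed: it places \<open>Field r\<close> and every
    preimage of a neighbourhood in \<open>?F\<close>.\<close>
  then have empty: "|{} :: 'l set| <o r" by (rule card_of_ordLess_mono[OF empty_subsetI])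
  have "filter_over (Field r) ?F"
    unfolding filter_over_def
  proof (intro conjI ballI allI impI)
    have "|(x -` topspace X \<inter> Field r) - Field r| <o r"
      by (rule card_of_ordLess_mono[OF _ empty]) blast
    with top show "Field r \<in> ?F" by blast
    show "{} \<notin> ?F"
    proof
      assume "{} \<in> ?F"
      then obtain U where "openin X U" "p \<in> U" "|x -` U \<inter> Field r| <o r" by auto
      then show False
        using acc not_ordLess_ordIso by (auto simp: complete_accumulation_point_def)
    qed
  next
    fix A B assume "A \<in> ?F" "B \<in> ?F"
    then obtain U V where UV: "openin X U" "p \<in> U" "|(x -` U \<inter> Field r) - A| <o r"
      "openin X V" "p \<in> V" "|(x -` V \<inter> Field r) - B| <o r" and A: "A \<subseteq> Field r" by blast
    have "(x -` (U \<inter> V) \<inter> Field r) - (A \<inter> B) \<subseteq>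
        ((x -` U \<inter> Field r) - A) \<union> ((x -` V \<inter> Field r) - B)" by blast
    then have "|(x -` (U \<inter> V) \<inter> Field r) - (A \<inter> B)| <o r"
      using Cinfinite_ordLess_Un[OF r UV(3,6)] by (rule card_of_ordLess_mono)
    moreover have "openin X (U \<inter> V)" "p \<in> U \<inter> V" using UV by auto
    ultimately show "A \<inter> B \<in> ?F" using A by blast
  next
    fix A B assume "A \<in> ?F" and B: "A \<subseteq> B \<and> B \<subseteq> Field r"
    then obtain U where U: "openin X U" "p \<in> U" "|(x -` U \<inter> Field r) - A| <o r" by blast
    have "(x -` U \<inter> Field r) - B \<subseteq> (x -` U \<inter> Field r) - A" using B by blast
    then have "|(x -` U \<inter> Field r) - B| <o r"
      using U(3) by (rule card_of_ordLess_mono)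
    with U B show "B \<in> ?F" by blast
  qed blast
  then obtain D where D: "ultrafilter_over (Field r) D" "?F \<subseteq> D"
    by (rule filter_over_extends_to_ultrafilter)
  have "|A| =o r" if A: "A \<in> D" for A
  proof (rule ccontr)
    assume "\<not> |A| =o r"
    moreover have sub: "A \<subseteq> Field r" using A D(1) by (auto simp: ultrafilter_over_def)
    ultimately have "|A| <o r" using Card_order_card_of_subset_cases[of r A] r by simp
    moreover have "(x -` topspace X \<inter> Field r) - (Field r - A) = A" using sub x by blast
    \<comment> \<open>With the whole space as neighbourhood, the indices missed by
      \<open>Field r - A\<close> are those of the small set \<open>A\<close>.\<close>
    ultimately have "Field r - A \<in> ?F"
      using top by (intro CollectI conjI exI[of _ "topspace X"]) simp_all
    with D(2) have "Field r - A \<in> D" by blast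
    with A have "A \<inter> (Field r - A) \<in> D"
      by (rule filter_over_Int[OF ultrafilter_over_imp_filter_over[OF D(1)]])
    then show False using D(1) by (simp add: ultrafilter_over_def)
  qed
  moreover have "x -` U \<inter> Field r \<in> D" if "openin X U" "p \<in> U" for U
  proof -
    have "|(x -` U \<inter> Field r) - (x -` U \<inter> Field r)| <o r" using empty by simp
    with that have "x -` U \<inter> Field r \<in> ?F" by blast
    with D(2) show ?thesis by blast
  qed
  ultimately show "\<exists>D. uniform_ultrafilter r D \<and> ultra_limit (Field r) D X x p"
    using D(1) top by (auto simp: uniform_ultrafilter_def ultra_limit_def)
next
  assume "\<exists>D. uniform_ultrafilter r D \<and> ultra_limit (Field r) D X x p"
  then show "complete_accumulation_point r X x p"
    by (auto simp: uniform_ultrafilter_def ultra_limit_def complete_accumulation_point_def)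
qed

text \<open>Without an accumulation point, the space is covered by open sets each met at boundedly
  many indices, and a small subcover would bound all indices. Conversely, from a cover without small
  subcover one picks, at stage \<open>a\<close>, a point missed by the members up to
  \<open>a\<close>; such a sequence meets each member only at small indices.\<close>

lemma interval_compact_space_iff_complete_accumulation_point:
  assumes r: "Cinfinite r" "regularCard r"
  shows "interval_compact_space r r X \<longleftrightarrow>
         (\<forall>x\<in>Field r \<rightarrow> topspace X. \<exists>p. complete_accumulation_point r X x p)"
proof (intro iffI ballI)
  fix x assume comp: "interval_compact_space r r X" and x: "x \<in> Field r \<rightarrow> topspace X"
  show "\<exists>p. complete_accumulation_point r X x p"
  proof (rule ccontr)
    assume no: "\<not> (\<exists>p. complete_accumulation_point r X x p)"
    \<comment> \<open>The largest open set that the sequence visits at no index beyond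
      \<open>b\<close>. Grouping neighbourhoods by their bound yields a cover with at most
      \<open>r\<close> members.\<close>
    define V where "V b = \<Union>{U. openin X U \<and> x -` U \<inter> Field r \<subseteq> under r b}" for b
    have V_open: "openin X (V b)" for b unfolding V_def by blast
    have V_under: "x -` V b \<inter> Field r \<subseteq> under r b" for b unfolding V_def by blast
    have cover: "\<Union>(V ` Field r) = topspace X"
    proof
      show "\<Union>(V ` Field r) \<subseteq> topspace X" using V_open openin_subset by fastforce
      show "topspace X \<subseteq> \<Union>(V ` Field r)"
      proof
        fix p assume "p \<in> topspace X"
        then obtain U where U: "openin X U" "p \<in> U" "\<not> |x -` U \<inter> Field r| =o r"
          using no by (auto simp: complete_accumulation_point_def)
        then obtain b where "b \<in> Field r" "x -` U \<inter> Field r \<subseteq> under r b"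
          using regularCard_bounded[of r "x -` U \<inter> Field r"] r by auto
        with U show "p \<in> \<Union>(V ` Field r)" unfolding V_def by blast
      qed
    qed
    have "|V ` Field r| \<le>o r"
      by (rule ordLeq_ordIso_trans[OF card_of_image card_of_Field_ordIso]) (simp add: r(1))
    then obtain \<W> where W: "\<W> \<subseteq> V ` Field r" "\<Union>\<W> = topspace X" "|\<W>| <o r"
      using comp[unfolded interval_compact_space_def, rule_format, of "V ` Field r"] cover V_open
      by auto
    \<comment> \<open>Distinct bounds may give the same \<open>V b\<close>, so one index per member
      of the subcover is chosen; then \<open>B\<close> is as small as the subcover and hence
      bounded.\<close>
    obtain B where B: "B \<subseteq> Field r" "inj_on V B" "\<W> = V ` B"
      using W(1) by (meson subset_image_inj)
    then have "|B| =o |\<W>|"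
      using card_of_ordIsoI[of V B \<W>] by (simp add: bij_betw_def)
    then have "|B| <o r" using W(3) by (rule ordIso_ordLess_trans)
    then have "\<not> |B| =o r" by (rule not_ordLess_ordIso)
    then obtain a where a: "a \<in> Field r" "B \<subseteq> under r a"
      using regularCard_bounded[of r B] r B(1) by auto
    have wo: "wo_rel r"
      using r(1) by (auto simp: wo_rel_def intro: card_order_on_well_order_on)
    have "c \<in> under r a" if c: "c \<in> Field r" for c
    proof -
      obtain b where b: "b \<in> B" "x c \<in> V b" using x c W(2) B(3) by blast
      then have "(c, b) \<in> r" "(b, a) \<in> r"
        using V_under[of b] c a(2) by (auto simp: under_def)
      then show ?thesis using wo_rel.TRANS[OF wo] by (auto simp: under_def dest: transD)
    qed
    then have "Field r \<subseteq> under r a" by blast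
    then have "|Field r| <o r"
      using Cinfinite_card_of_under[OF r(1) a(1)] by (rule card_of_ordLess_mono)
    then show False using card_of_Field_ordIso[of r] r(1) not_ordLess_ordIso by auto
  qed
next
  assume acc: "\<forall>x\<in>Field r \<rightarrow> topspace X. \<exists>p. complete_accumulation_point r X x p"
  show "interval_compact_space r r X"
    unfolding interval_compact_space_def
  proof (intro allI impI, elim conjE)
    fix \<U> assume U: "\<forall>U\<in>\<U>. openin X U" "\<Union>\<U> = topspace X" "|\<U>| \<le>o r"
    show "\<exists>\<V>\<subseteq>\<U>. \<Union>\<V> = topspace X \<and> |\<V>| <o r"
    proof (rule ccontr)
      assume no: "\<not> (\<exists>\<V>\<subseteq>\<U>. \<Union>\<V> = topspace X \<and> |\<V>| <o r)"
      \<comment> \<open>The cover is a subcover of itself, so it has exactly \<open>r\<close>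
        members and can be enumerated by \<open>Field r\<close>.\<close>
      have "\<not> |\<U>| <o r" using no U(2) by blast
      with U(3) have "|\<U>| =o r" by (simp add: ordLeq_iff_ordLess_or_ordIso)
      then have "r =o |\<U>|" by (rule ordIso_symmetric)
      with card_of_Field_ordIso[OF conjunct2[OF r(1)]] have "|Field r| =o |\<U>|"
        by (rule ordIso_transitive)
      then obtain e where e: "bij_betw e (Field r) \<U>"
        unfolding card_of_ordIso[symmetric] by (rule exE)
      have "\<exists>q. q \<in> topspace X \<and> q \<notin> \<Union>(e ` under r a)" if a: "a \<in> Field r" for a
      proof -
        have sub: "e ` under r a \<subseteq> \<U>"
          using e under_Field[of r a] by (auto simp: bij_betw_def)
        moreover have "|e ` under r a| <o r"
          using card_of_image Cinfinite_card_of_under[OF r(1) a] by (rule ordLeq_ordLess_trans)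
        ultimately have "\<Union>(e ` under r a) \<noteq> topspace X" using no by blast
        moreover have "\<Union>(e ` under r a) \<subseteq> topspace X" using sub U(2) by blast
        ultimately show ?thesis by blast
      qed
      then obtain x where x: "\<And>a. a \<in> Field r \<Longrightarrow> x a \<in> topspace X \<and> x a \<notin> \<Union>(e ` under r a)"
        by metis
      then have "x \<in> Field r \<rightarrow> topspace X" by blast
      then obtain p where p: "complete_accumulation_point r X x p" using acc by blast
      then have "p \<in> \<Union>\<U>" using U(2) by (simp add: complete_accumulation_point_def)
      then obtain b where b: "b \<in> Field r" "p \<in> e b" "e b \<in> \<U>"
        using e by (auto simp: bij_betw_def)
      then have "|x -` e b \<inter> Field r| =o r"
        using p U(1) by (auto simp: complete_accumulation_point_def)
      \<comment> \<open>By choice \<open>x a\<close> avoids \<open>e b\<close> whenever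
        \<open>b\<close> is at most \<open>a\<close>, so the sequence enters \<open>e b\<close> only
        at indices before \<open>b\<close>, too few for accumulation.\<close>
      moreover have "x -` e b \<inter> Field r \<subseteq> under r b"
      proof
        fix a assume a: "a \<in> x -` e b \<inter> Field r"
        then have "b \<notin> under r a" using x[of a] by blast
        then have "b \<in> aboveS r a" using Card_order_not_under_iff[of r a b] r(1) a b(1) by simp
        then show "a \<in> under r b" by (simp add: under_def aboveS_def)
      qed
      ultimately show False
        using not_ordLess_ordIso[OF card_of_ordLess_mono[OF _ Cinfinite_card_of_under[OF r(1) b(1)]]]
        by simp
    qed
  qed
qed

subsection \<open>Products of regular cardinals\<close>

theorem theorem3:
  fixes \<kappa> :: "'k rel" and lam :: "'l rel" and \<mu> :: "'k \<Rightarrow> 'm rel"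
  assumes "Cinfinite \<kappa>"
    and "Cinfinite lam" and "regularCard lam"
    and "\<And>\<gamma>. \<gamma> \<in> Field \<kappa> \<Longrightarrow> Cinfinite (\<mu> \<gamma>)"
    and "\<And>\<gamma>. \<gamma> \<in> Field \<kappa> \<Longrightarrow> regularCard (\<mu> \<gamma>)"
  shows "(interval_compact_space lam lam
            (product_topology (\<lambda>\<gamma>. order_topology_of (\<mu> \<gamma>)) (Field \<kappa>))
          \<longleftrightarrow> \<not> ultra_arrow lam \<kappa> \<mu>) \<and>
         (\<not> ultra_arrow lam \<kappa> \<mu> \<longleftrightarrow>
            (\<forall>f. (\<forall>\<gamma>\<in>Field \<kappa>. f \<gamma> \<in> Field lam \<rightarrow> Field (\<mu> \<gamma>)) \<longrightarrow>
               (\<exists>D. uniform_ultrafilter lam D \<and>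
                  \<not> (\<exists>\<gamma>\<in>Field \<kappa>. uniform_ultrafilter (\<mu> \<gamma>)
                       (image_ultrafilter (Field lam) (Field (\<mu> \<gamma>)) (f \<gamma>) D)))))"
proof -
  let ?X = "\<lambda>\<gamma>. order_topology_of (\<mu> \<gamma>)"
  let ?P = "product_topology ?X (Field \<kappa>)"
  let ?nonuniform = "\<lambda>f D. \<not> (\<exists>\<gamma>\<in>Field \<kappa>. uniform_ultrafilter (\<mu> \<gamma>)
                       (image_ultrafilter (Field lam) (Field (\<mu> \<gamma>)) (f \<gamma>) D))"
  \<comment> \<open>For one fixed \<open>D\<close>, the limit in the product exists iff each
    coordinate has a limit, hence iff no coordinate image is uniform.\<close>
  have limit: "(\<exists>p. ultra_limit (Field lam) D ?P x p) \<longleftrightarrow> ?nonuniform (\<lambda>\<gamma> a. x a \<gamma>) D"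
    if D: "uniform_ultrafilter lam D" and x: "x \<in> Field lam \<rightarrow> topspace ?P" for D x
  proof -
    have uf: "ultrafilter_over (Field lam) D" using D by (simp add: uniform_ultrafilter_def)
    then have fo: "filter_over (Field lam) D" by (simp add: ultrafilter_over_iff)
    have x': "x \<in> Field lam \<rightarrow> (\<Pi>\<^sub>E \<gamma>\<in>Field \<kappa>. topspace (?X \<gamma>))" using x by simp
    note prod = ultra_limit_product_topology[OF fo x']
    have "(\<exists>p. ultra_limit (Field lam) D ?P x p) \<longleftrightarrow>
        (\<forall>\<gamma>\<in>Field \<kappa>. \<exists>q. ultra_limit (Field lam) D (?X \<gamma>) (\<lambda>a. x a \<gamma>) q)"
    proof
      assume "\<exists>p. ultra_limit (Field lam) D ?P x p"
      then obtain p where p: "ultra_limit (Field lam) D ?P x p" ..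
      moreover from p have "p \<in> (\<Pi>\<^sub>E \<gamma>\<in>Field \<kappa>. topspace (?X \<gamma>))"
        by (simp add: ultra_limit_def)
      ultimately show "\<forall>\<gamma>\<in>Field \<kappa>. \<exists>q. ultra_limit (Field lam) D (?X \<gamma>) (\<lambda>a. x a \<gamma>) q"
        using prod by blast
    next
      assume "\<forall>\<gamma>\<in>Field \<kappa>. \<exists>q. ultra_limit (Field lam) D (?X \<gamma>) (\<lambda>a. x a \<gamma>) q"
      then obtain q where
        q: "\<And>\<gamma>. \<gamma> \<in> Field \<kappa> \<Longrightarrow> ultra_limit (Field lam) D (?X \<gamma>) (\<lambda>a. x a \<gamma>) (q \<gamma>)"
        by metis
      \<comment> \<open>Points of the product are extensional functions, so the chosen coordinate
        limits are cut down to \<open>Field \<kappa>\<close>.\<close>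
      then have "restrict q (Field \<kappa>) \<in> (\<Pi>\<^sub>E \<gamma>\<in>Field \<kappa>. topspace (?X \<gamma>))"
        by (simp add: ultra_limit_def)
      from prod[OF this] q show "\<exists>p. ultra_limit (Field lam) D ?P x p" by auto
    qed
    also have "\<dots> \<longleftrightarrow> ?nonuniform (\<lambda>\<gamma> a. x a \<gamma>) D"
    proof -
      have "(\<exists>q. ultra_limit (Field lam) D (?X \<gamma>) (\<lambda>a. x a \<gamma>) q) \<longleftrightarrow>
          \<not> uniform_ultrafilter (\<mu> \<gamma>)
            (image_ultrafilter (Field lam) (Field (\<mu> \<gamma>)) (\<lambda>a. x a \<gamma>) D)"
        if \<gamma>: "\<gamma> \<in> Field \<kappa>" for \<gamma>
        using assms(4,5)[OF \<gamma>] uf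
      proof (rule ultra_limit_order_topology_iff)
        show "(\<lambda>a. x a \<gamma>) \<in> Field lam \<rightarrow> Field (\<mu> \<gamma>)" using x \<gamma> by (auto simp: PiE_iff Pi_iff)
      qed
      then show ?thesis by blast
    qed
    finally show ?thesis .
  qed
  have "interval_compact_space lam lam ?P \<longleftrightarrow>
      (\<forall>x\<in>Field lam \<rightarrow> topspace ?P. \<exists>p. complete_accumulation_point lam ?P x p)"
    using assms(2,3) by (rule interval_compact_space_iff_complete_accumulation_point)
  also have "\<dots> \<longleftrightarrow> (\<forall>x\<in>Field lam \<rightarrow> topspace ?P.
      \<exists>D. uniform_ultrafilter lam D \<and> ?nonuniform (\<lambda>\<gamma> a. x a \<gamma>) D)"
  proof (intro ball_cong refl)
    fix x assume x: "x \<in> Field lam \<rightarrow> topspace ?P"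
    have "(\<exists>p. complete_accumulation_point lam ?P x p) \<longleftrightarrow>
        (\<exists>D. uniform_ultrafilter lam D \<and> (\<exists>p. ultra_limit (Field lam) D ?P x p))"
      unfolding complete_accumulation_point_iff_ultra_limit[OF assms(2) x] by blast
    also have "\<dots> \<longleftrightarrow> (\<exists>D. uniform_ultrafilter lam D \<and> ?nonuniform (\<lambda>\<gamma> a. x a \<gamma>) D)"
      by (intro ex_cong1 conj_cong refl limit x)
    finally show "(\<exists>p. complete_accumulation_point lam ?P x p) \<longleftrightarrow>
        (\<exists>D. uniform_ultrafilter lam D \<and> ?nonuniform (\<lambda>\<gamma> a. x a \<gamma>) D)" .
  qed
  \<comment> \<open>Swapping the two arguments identifies sequences of points in the product with
    families of functions, up to values outside \<open>Field \<kappa>\<close>, which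
    \<open>?nonuniform\<close> never inspects.\<close>
  also have "\<dots> \<longleftrightarrow> (\<forall>f. (\<forall>\<gamma>\<in>Field \<kappa>. f \<gamma> \<in> Field lam \<rightarrow> Field (\<mu> \<gamma>)) \<longrightarrow>
      (\<exists>D. uniform_ultrafilter lam D \<and> ?nonuniform f D))"
  proof (intro iffI allI impI ballI)
    fix f assume *: "\<forall>x\<in>Field lam \<rightarrow> topspace ?P.
        \<exists>D. uniform_ultrafilter lam D \<and> ?nonuniform (\<lambda>\<gamma> a. x a \<gamma>) D"
      and f: "\<forall>\<gamma>\<in>Field \<kappa>. f \<gamma> \<in> Field lam \<rightarrow> Field (\<mu> \<gamma>)"
    define x where "x a = restrict (\<lambda>\<gamma>. f \<gamma> a) (Field \<kappa>)" for a
    have "x \<in> Field lam \<rightarrow> topspace ?P" using f by (auto simp: x_def Pi_iff)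
    then obtain D where "uniform_ultrafilter lam D" "?nonuniform (\<lambda>\<gamma> a. x a \<gamma>) D"
      using * by blast
    then show "\<exists>D. uniform_ultrafilter lam D \<and> ?nonuniform f D"
      by (auto simp: x_def)
  next
    fix x assume *: "\<forall>f. (\<forall>\<gamma>\<in>Field \<kappa>. f \<gamma> \<in> Field lam \<rightarrow> Field (\<mu> \<gamma>)) \<longrightarrow>
      (\<exists>D. uniform_ultrafilter lam D \<and> ?nonuniform f D)"
      and x: "x \<in> Field lam \<rightarrow> topspace ?P"
    have "\<forall>\<gamma>\<in>Field \<kappa>. (\<lambda>a. x a \<gamma>) \<in> Field lam \<rightarrow> Field (\<mu> \<gamma>)"
      using x by (auto simp: PiE_iff Pi_iff)
    then show "\<exists>D. uniform_ultrafilter lam D \<and> ?nonuniform (\<lambda>\<gamma> a. x a \<gamma>) D"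
      using *[rule_format, of "\<lambda>\<gamma> a. x a \<gamma>"] by blast
  qed
  finally have compact: "interval_compact_space lam lam ?P \<longleftrightarrow>
      (\<forall>f. (\<forall>\<gamma>\<in>Field \<kappa>. f \<gamma> \<in> Field lam \<rightarrow> Field (\<mu> \<gamma>)) \<longrightarrow>
        (\<exists>D. uniform_ultrafilter lam D \<and> ?nonuniform f D))" .
  have "\<not> ultra_arrow lam \<kappa> \<mu> \<longleftrightarrow>
      (\<forall>f. (\<forall>\<gamma>\<in>Field \<kappa>. f \<gamma> \<in> Field lam \<rightarrow> Field (\<mu> \<gamma>)) \<longrightarrow>
        (\<exists>D. uniform_ultrafilter lam D \<and> ?nonuniform f D))"
    unfolding ultra_arrow_def not_ex de_Morgan_conj not_all not_imp by (simp only: imp_conv_disj)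
  with compact show ?thesis by simp
qed

end
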